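(* For every integer $n\ge 1$, $$F_{2n}(s) = \sum_{k=0}^{n-1} a(n,k)\, F_{2k+1}(s), \qquad\text{where}\qquad a(n,k) = (-1)^{n-k-1}\frac{1}{2k+1}\binom{2n}{2k}G_{2n-2k}.$$
   Context: The Fibonacci polynomials $F_n(s)$ are defined by $F_0(s)=0$, $F_1(s)=1$ and $F_n(s)=F_{n-1}(s)+sF_{n-2}(s)$ for $n\ge 2$; explicitly $F_n(s)=\sum_{k=0}^{n-1}\binom{n-k-1}{k}s^k$ for $n \ge 1$. The Genocchi numbers $(G_{2n})_{n\ge 1} = (1,1,3,17,155,2073,\dots)$ are defined by $\frac{2z}{1+e^z} = z+\sum_{n\ge 1}(-1)^n G_{2n}\frac{z^{2n}}{(2n)!}$. *)

theory Defs
  imports "HOL-Computational_Algebra.Computational_Algebra"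
begin

fun fib_poly :: "nat \<Rightarrow> rat poly" where
  "fib_poly 0 = 0"
| "fib_poly (Suc 0) = 1"
| "fib_poly (Suc (Suc n)) = fib_poly (Suc n) + [:0, 1:] * fib_poly n"

definition genocchi_fps :: "rat fps" where
  "genocchi_fps = 2 * fps_X / (1 + fps_exp 1)"

text \<open>
  The argument of \<open>genocchi\<close> is the full index, so that \<open>G\<^sub>2\<^sub>n\<close> is \<open>genocchi (2 * n)\<close>. Its
  values at odd arguments and at \<open>0\<close> play no role. The defining equation of the Genocchi
  numbers is \<open>genocchi_gen_fun\<close> below.
\<close>

definition genocchi :: "nat \<Rightarrow> rat" where
  "genocchi m = (-1) ^ (m div 2) * fact m * fps_nth genocchi_fps m"

lemma genocchi_fps_times: "genocchi_fps * (1 + fps_exp 1) = 2 * fps_X"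
proof -
  have nz: "fps_nth (1 + fps_exp (1::rat)) 0 \<noteq> 0" by simp
  show ?thesis
    unfolding genocchi_fps_def fps_divide_unit[OF nz]
    using inverse_mult_eq_1[OF nz] by (simp add: mult.assoc)
qed

lemma genocchi_fps_odd_part: "genocchi_fps - (genocchi_fps oo - fps_X) = 2 * fps_X"
proof -
  let ?E = "fps_exp (1::rat)" and ?H = "genocchi_fps oo - fps_X"
  have "(genocchi_fps * (1 + ?E)) oo - fps_X = (2 * fps_X) oo - fps_X"
    by (simp only: genocchi_fps_times)
  hence H: "?H * (1 + fps_exp (-1)) = - 2 * fps_X"
    by (simp add: fps_compose_mult_distrib fps_compose_add_distrib)
  have inv: "fps_exp (-1) * ?E = 1"
    using fps_exp_add_mult[of "-1::rat" 1] by simp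
  have "?H * (1 + ?E) = ?H * (1 + fps_exp (-1)) * ?E"
    using inv by (simp add: algebra_simps)
  hence "?H * (1 + ?E) = - 2 * fps_X * ?E"
    by (simp only: H)
  hence "(genocchi_fps - ?H) * (1 + ?E) = 2 * fps_X * (1 + ?E)"
    using genocchi_fps_times by (simp add: algebra_simps)
  moreover have "fps_nth (1 + ?E) 0 \<noteq> 0" by simp
  hence "1 + ?E \<noteq> 0" by (metis fps_zero_nth)
  ultimately show ?thesis by simp
qed

lemma genocchi_gen_fun:
  "2 * fps_X / (1 + fps_exp 1) =
    fps_X + Abs_fps (\<lambda>m. if even m \<and> m > 0 then (-1) ^ (m div 2) * genocchi m / fact m else 0)"
proof (rule fps_ext)
  fix m
  have "fps_nth (genocchi_fps - (genocchi_fps oo - fps_X)) m = fps_nth (2 * fps_X) m"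
    by (simp only: genocchi_fps_odd_part)
  hence odd_part: "odd m \<Longrightarrow> fps_nth genocchi_fps m = (if m = 1 then 1 else 0)"
    by (cases "m = 1") (auto simp: fps_compose_uminus' numeral_fps_const split: if_splits)
  have zero: "fps_nth genocchi_fps 0 = 0"
    by (simp add: genocchi_fps_def fps_divide_unit)
  show "fps_nth (2 * fps_X / (1 + fps_exp 1)) m = fps_nth (fps_X +
    Abs_fps (\<lambda>m. if even m \<and> m > 0 then (-1) ^ (m div 2) * genocchi m / fact m else 0)) m"
    unfolding genocchi_fps_def[symmetric]
    using odd_part zero by (cases "even m") (auto simp: genocchi_def)
qed

end

theory Submission
  imports Defs
begin

text \<open>
  The exponential generating function \<open>P(z) = \<Sum> F\<^sub>n(s) z\<^sup>n / n!\<close> satisfies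
  \<open>P'' = P' + s P\<close>, and so does \<open>- e\<^sup>z P(-z)\<close>, with the same initial values; hence
  \<open>P(z) = - e\<^sup>z P(-z)\<close>. For the even part \<open>E\<close> and the odd part \<open>O\<close> of \<open>P\<close> this says
  \<open>(1 + e\<^sup>z) E = (e\<^sup>z - 1) O\<close>. Since \<open>z (e\<^sup>z - 1) / (1 + e\<^sup>z) = z - 2z / (1 + e\<^sup>z)\<close>,
  we get \<open>z E = (z - 2z / (1 + e\<^sup>z)) O\<close>, and the theorem compares the coefficients
  of \<open>z\<^bsup>2n+1\<^esup>\<close>.
\<close>

text \<open>Comparing coefficients of z^n, the equation determines the coefficient at n + 2 from the
  two before it, because (n + 1)(n + 2) is nonzero in characteristic 0.\<close>

lemma fps_second_order_ode_unique:
  fixes A B :: "'a::field_char_0 fps"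
  assumes A: "fps_deriv (fps_deriv A) = fps_deriv A + fps_const s * A"
    and B: "fps_deriv (fps_deriv B) = fps_deriv B + fps_const s * B"
    and at0: "fps_nth A 0 = fps_nth B 0" and at1: "fps_nth A 1 = fps_nth B 1"
  shows "A = B"
proof -
  have "fps_nth A n = fps_nth B n \<and> fps_nth A (Suc n) = fps_nth B (Suc n)" for n
  proof (induction n)
    case 0
    then show ?case using at0 at1 by simp
  next
    case (Suc n)
    have "fps_nth (fps_deriv (fps_deriv A)) n = fps_nth (fps_deriv (fps_deriv B)) n"
      unfolding A B using Suc by simp
    hence "of_nat (n + 1) * (of_nat (n + 2) * fps_nth A (n + 2)) =
        of_nat (n + 1) * (of_nat (n + 2) * fps_nth B (n + 2))"
      by (simp add: algebra_simps)
    hence "fps_nth A (n + 2) = fps_nth B (n + 2)"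
      by (metis Suc_eq_plus1 add_2_eq_Suc' mult_cancel_left of_nat_neq_0)
    with Suc show ?case by simp
  qed
  thus ?thesis by (intro fps_ext) blast
qed

definition egf :: "(nat \<Rightarrow> 'a::field_char_0) \<Rightarrow> 'a fps" where
  "egf f = Abs_fps (\<lambda>n. f n / fact n)"

lemma fps_nth_egf [simp]: "fps_nth (egf f) n = f n / fact n"
  by (simp add: egf_def)

lemma fps_deriv_egf: "fps_deriv (egf f) = egf (\<lambda>n. f (Suc n))"
  by (rule fps_ext) (simp del: of_nat_Suc)

lemma egf_reflection:
  fixes f :: "nat \<Rightarrow> 'a::field_char_0"
  assumes rec: "\<And>n. f (Suc (Suc n)) = f (Suc n) + s * f n" and "f 0 = 0"
  shows "fps_exp 1 * egf (\<lambda>n. (-1) ^ n * f n) = - egf f"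
proof -
  define H where "H = egf (\<lambda>n. (-1) ^ n * f n)"
  define e where "e = fps_exp (1::'a)"
  have e': "fps_deriv e = e" by (simp add: e_def)
  have H2: "fps_deriv (fps_deriv H) = fps_const s * H - fps_deriv H"
    unfolding H_def fps_deriv_egf by (rule fps_ext) (simp add: rec field_simps)
  have "- (e * H) = egf f"
  proof (rule fps_second_order_ode_unique)
    \<comment> \<open>The product rule gives (eH)'' = e(H + 2H' + H''), which \<open>H2\<close>
      turns into e(H + H') + s e H.\<close>
    show "fps_deriv (fps_deriv (- (e * H))) = fps_deriv (- (e * H)) + fps_const s * - (e * H)"
      by (simp add: e' H2 algebra_simps)
    show "fps_deriv (fps_deriv (egf f)) = fps_deriv (egf f) + fps_const s * egf f"
      unfolding fps_deriv_egf by (rule fps_ext) (simp add: rec field_simps)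
  qed (use \<open>f 0 = 0\<close> in \<open>simp_all add: H_def e_def fps_mult_nth\<close>)
  thus ?thesis unfolding H_def e_def by (metis minus_minus)
qed

text \<open>For H(z) = P(-z), \<open>P + H\<close> and \<open>P - H\<close> are twice the even and
  odd parts of \<open>P\<close>. Multiplied by 1 + e^z, which can be cancelled, both sides become z
  (e^z - 1)(P - H).\<close>

lemma egf_parts_genocchi:
  fixes P H :: "rat fps"
  assumes refl: "fps_exp 1 * H = - P"
  shows "fps_X * (P + H) = (P - H) * (fps_X - genocchi_fps)"
proof -
  let ?e = "fps_exp (1::rat)"
  have "fps_nth (1 + ?e) 0 \<noteq> 0" by simp
  hence nz: "1 + ?e \<noteq> 0" by (metis fps_zero_nth)
  have "(fps_X - genocchi_fps) * (1 + ?e) = fps_X * (?e - 1)"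
    using genocchi_fps_times by (simp add: algebra_simps)
  moreover have "(P + H) * (1 + ?e) = (P - H) * (?e - 1)"
    using refl by (simp add: algebra_simps)
  ultimately have "fps_X * (P + H) * (1 + ?e) = (P - H) * (fps_X - genocchi_fps) * (1 + ?e)"
    by (simp only: mult.assoc mult.left_commute)
  with nz show ?thesis by simp
qed

text \<open>Meant for the values of the Fibonacci polynomials at a fixed \<open>s\<close>, so that
  the generating functions have coefficients in a field.\<close>

lemma even_term_genocchi:
  fixes f :: "nat \<Rightarrow> rat"
  assumes rec: "\<And>n. f (Suc (Suc n)) = f (Suc n) + s * f n" and "f 0 = 0" and "n \<ge> 1"
  shows "f (2 * n) = (\<Sum>k = 0..n - 1. (-1) ^ (n - k - 1) * (1 / of_nat (2 * k + 1)) *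
    of_nat ((2 * n) choose (2 * k)) * genocchi (2 * n - 2 * k) * f (2 * k + 1))"
proof -
  define P where "P = egf f"
  define H where "H = egf (\<lambda>n. (-1) ^ n * f n)"
  define G where "G = genocchi_fps"
  have G0: "fps_nth G 0 = 0"
    by (simp add: G_def genocchi_fps_def fps_divide_unit)
  have eq: "fps_X * (P + H) = (P - H) * (fps_X - G)"
    unfolding G_def using egf_reflection[of f s, OF rec \<open>f 0 = 0\<close>]
    by (intro egf_parts_genocchi) (simp add: P_def H_def)
  have "2 * f (2 * n) / fact (2 * n) = fps_nth (fps_X * (P + H)) (Suc (2 * n))"
    by (simp add: P_def H_def)
  \<comment> \<open>The lower bound \<open>2 * 0\<close> lets \<open>sum.in_pairs\<close> group the
    indices 2k and 2k + 1; those at 2k then drop out, since \<open>P - H\<close> is odd.\<close>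
  also have "\<dots> = (\<Sum>i = 2 * 0..Suc (2 * n).
      fps_nth (P - H) i * fps_nth (fps_X - G) (Suc (2 * n) - i))"
    unfolding eq fps_mult_nth by simp
  also have "\<dots> = (\<Sum>k = 0..n. 2 * f (2 * k + 1) / fact (2 * k + 1) *
      fps_nth (fps_X - G) (2 * n - 2 * k))"
    unfolding sum.in_pairs by (simp add: P_def H_def mult_ac)
  \<comment> \<open>The index 2n - 2k is even, hence never 1, so \<open>fps_X\<close> contributes
    nothing.\<close>
  also have "\<dots> = (\<Sum>k = 0..n. 2 * f (2 * k + 1) / fact (2 * k + 1) *
      - fps_nth G (2 * n - 2 * k))"
    by (intro sum.cong refl arg_cong2[of _ _ _ _ "(*)"]) (auto, presburger)
  \<comment> \<open>The term k = n is split off because it vanishes by \<open>G0\<close>.\<close>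
  also have "{0..n} = insert n {0..n - 1}" using \<open>n \<ge> 1\<close> by auto
  finally have "f (2 * n) / fact (2 * n) = (\<Sum>k = 0..n - 1. f (2 * k + 1) / fact (2 * k + 1) *
      - fps_nth G (2 * n - 2 * k))"
    using \<open>n \<ge> 1\<close> G0 by (simp add: sum_negf sum_distrib_left[symmetric] mult.assoc
        flip: times_divide_eq_right)
  hence "f (2 * n) = (\<Sum>k = 0..n - 1. fact (2 * n) * (f (2 * k + 1) / fact (2 * k + 1) *
      - fps_nth G (2 * n - 2 * k)))"
    unfolding sum_distrib_left[symmetric] by (simp add: field_simps)
  also have "\<dots> = (\<Sum>k = 0..n - 1. (-1) ^ (n - k - 1) * (1 / of_nat (2 * k + 1)) *
    of_nat ((2 * n) choose (2 * k)) * genocchi (2 * n - 2 * k) * f (2 * k + 1))"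
  proof (rule sum.cong[OF refl])
    fix k assume "k \<in> {0..n - 1}"
    hence k: "k < n" using \<open>n \<ge> 1\<close> by auto
    define d where "d = n - k - 1"
    have n: "n = Suc (k + d)" using k by (simp add: d_def)
    define D :: rat where "D = of_nat (2 * k + 1)"
    have D: "D \<noteq> 0" by (simp add: D_def del: of_nat_Suc of_nat_add)
    have choose: "of_nat ((2 * n) choose (2 * k)) =
        (fact (2 * n) / (fact (2 * k) * fact (2 * n - 2 * k)) :: rat)"
      using k by (simp add: binomial_fact)
    have fact1: "fact (2 * k + 1) = D * (fact (2 * k) :: rat)"
      by (simp add: D_def)
    have gen: "genocchi (2 * n - 2 * k) =
        (-1) ^ Suc d * fact (2 * n - 2 * k) * fps_nth G (2 * n - 2 * k)"
    proof -
      have "(2 * n - 2 * k) div 2 = Suc d" unfolding n by simp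
      thus ?thesis by (simp only: genocchi_def G_def)
    qed
    \<comment> \<open>The sign inside \<open>genocchi\<close> is (-1)^(n-k), opposite to the sign in
      the claim; their product is the minus before \<open>fps_nth G\<close>.\<close>
    have sgn: "(-1) ^ d * (-1) ^ Suc d = (-1 :: rat)"
      by (simp flip: power_mult_distrib)
    show "fact (2 * n) * (f (2 * k + 1) / fact (2 * k + 1) * - fps_nth G (2 * n - 2 * k)) =
      (-1) ^ (n - k - 1) * (1 / of_nat (2 * k + 1)) *
      of_nat ((2 * n) choose (2 * k)) * genocchi (2 * n - 2 * k) * f (2 * k + 1)"
      (is "?L = ?R")
    proof -
      have "?R = ((-1) ^ d * (-1) ^ Suc d) * (1 / D) *
          (fact (2 * n) / (fact (2 * k) * fact (2 * n - 2 * k))) *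
          (fact (2 * n - 2 * k) * fps_nth G (2 * n - 2 * k)) * f (2 * k + 1)"
        unfolding gen choose D_def[symmetric] d_def[symmetric] by (simp only: mult_ac)
      also have "\<dots> = ?L"
        unfolding sgn fact1 using D by (simp add: field_simps)
      finally show ?thesis by simp
    qed
  qed
  finally show ?thesis .
qed

theorem corollary1p3:
  fixes n :: nat
  assumes "n \<ge> 1"
  shows "fib_poly (2 * n) =
    (\<Sum>k = 0..n - 1.
      smult ((-1) ^ (n - k - 1) * (1 / of_nat (2 * k + 1)) * of_nat ((2 * n) choose (2 * k))
               * genocchi (2 * n - 2 * k))
        (fib_poly (2 * k + 1)))"
\<comment> \<open>Over the infinite field of rationals, polynomials with the same values are
  equal.\<close>
proof (rule poly_eq_poly_eq_iff[THEN iffD1], rule ext)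
  fix s :: rat
  show "poly (fib_poly (2 * n)) s = poly (\<Sum>k = 0..n - 1.
      smult ((-1) ^ (n - k - 1) * (1 / of_nat (2 * k + 1)) * of_nat ((2 * n) choose (2 * k))
               * genocchi (2 * n - 2 * k))
        (fib_poly (2 * k + 1))) s"
    unfolding poly_sum poly_smult
    by (rule even_term_genocchi[where s = s]) (use assms in simp_all)
qed

end
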